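(* For every $s\in\mathcal{S}$, $\zeta(s)=0$ if and only if $F(s)=0$.
   Context: $\zeta(s)$ is the Riemann zeta function (meromorphically continued to $\mathbb{C}$). $\mathcal{S}:=\{s\in\mathbb{C}:0<\mathrm{Re}(s)<1\}$ is the open critical strip. The function $F$ is defined by $$F(s):=\int_{0}^{\infty}\frac{t^{s-1}}{e^t+1}\,dt,$$ which is considered here for $s\in\mathcal{S}$. *)

theory Defs
  imports "HOL-Complex_Analysis.Complex_Analysis"
begin

text \<open>
  The zeta function is the meromorphic continuation to the whole plane of the Dirichlet series
  \<open>\<Sum>n\<ge>1. n powr (-s)\<close>, which converges (absolutely) for \<open>Re s > 1\<close>. A function that is
  \<^const>\<open>nicely_meromorphic_on\<close> the plane has the value 0 at its poles and agrees with its limit at all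
  other points. So the continuation is a unique total function by the identity theorem.
\<close>

definition zeta :: "complex \<Rightarrow> complex" where
  "zeta = (THE f. f nicely_meromorphic_on UNIV \<and>
                  (\<forall>s. Re s > 1 \<longrightarrow> f s = (\<Sum>n. 1 / of_nat (Suc n) powr s)))"

definition critical_strip :: "complex set" where
  "critical_strip = {s. 0 < Re s \<and> Re s < 1}"

definition F :: "complex \<Rightarrow> complex" where
  "F s = (LBINT t:{0<..}. of_real t powr (s - 1) / of_real (exp t + 1))"

end

theory Submission
  imports Defs "HOL-Real_Asymp.Real_Asymp"
begin

text \<open>
  On \<open>Re s > 1\<close>, expanding \<open>1 / (e\<^sup>t + 1)\<close> in powers of \<open>e\<^sup>-\<^sup>t\<close> and integrating termwise
  gives \<open>F s = \<Gamma>(s) \<eta>(s)\<close> with the alternating series \<open>\<eta>(s) = 1 - 2\<^sup>-\<^sup>s + 3\<^sup>-\<^sup>s - \<dots>\<close>, and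
  splitting off the even terms gives \<open>\<eta>(s) = (1 - 2\<^sup>1\<^sup>-\<^sup>s) \<zeta>(s)\<close>. If the resulting identity
  \<open>F s = \<Gamma>(s) (1 - 2\<^sup>1\<^sup>-\<^sup>s) \<zeta>(s)\<close> persists in the critical strip, the theorem follows: \<open>\<Gamma>\<close> has no
  zeros, and \<open>1 - 2\<^sup>1\<^sup>-\<^sup>s\<close> vanishes only on the line \<open>Re s = 1\<close>.

  Since \<open>zeta\<close> is given by a definite description over functions meromorphic on the whole plane,
  nothing can be said about it in the strip before such a function has been exhibited and shown to
  be unique. The integral itself supplies it. Repeated integration by parts moves
  derivatives onto \<open>1 / (e\<^sup>t + 1)\<close>, all of which decay like \<open>e\<^sup>-\<^sup>t\<close>, and the factors \<open>s + k\<close> that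
  appear are absorbed by \<open>1/\<Gamma>\<close>. So \<open>F s / \<Gamma>(s)\<close> extends to an entire function \<open>E\<close>
  (\<open>rGamma_mellin_entire\<close>, \<open>rGamma_F_entire\<close>). The quotient \<open>E s / (1 - 2\<^sup>1\<^sup>-\<^sup>s)\<close>, with its removable
  singularities removed, is then meromorphic on the plane and equals the Dirichlet series for
  \<open>Re s > 1\<close> (\<open>rGamma_F_eq_dirichlet\<close>). By the identity theorem (\<open>nicely_meromorphic_unique\<close>) it is
  \<open>zeta\<close>, and the formula for \<open>zeta\<close> in the strip is then read off (\<open>zeta_eq_F\<close>).
\<close>

section \<open>Mellin transforms of exponentially decaying functions\<close>

text \<open>
  The decay is required of all \<open>t > 0\<close>, so it also includes boundedness near 0; this is what
  makes the Mellin transform converge on the whole half-plane \<open>Re s > 0\<close>.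
\<close>

definition exp_decaying :: "(real \<Rightarrow> complex) \<Rightarrow> bool" where
  "exp_decaying \<phi> \<longleftrightarrow>
     continuous_on {0<..} \<phi> \<and> (\<exists>C. \<forall>t>0. norm (\<phi> t) \<le> C * exp (- t))"

definition mellin :: "(real \<Rightarrow> complex) \<Rightarrow> complex \<Rightarrow> complex" where
  "mellin \<phi> s = (LBINT t:{0<..}. of_real t powr (s - 1) * \<phi> t)"

lemma set_integrable_powr_exp:
  fixes a b :: real
  assumes "a > 0" "b > 0"
  shows "set_integrable lborel {0<..} (\<lambda>t. t powr (a - 1) * exp (- (b * t)))"
proof -
  let ?f = "\<lambda>t::real. t powr (a - 1) * exp (- (b * t))"
  have "(\<lambda>t. complex_of_real t powr (of_real a - 1) / of_real (exp (b * t)))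
          absolutely_integrable_on {0<..}"
    by (rule absolutely_integrable_Gamma_integral) (use assms in auto)
  then have "(\<lambda>t. norm (complex_of_real t powr (of_real a - 1) / of_real (exp (b * t))))
          absolutely_integrable_on {0<..}"
    by (rule absolutely_integrable_norm[unfolded o_def])
  also have "?this \<longleftrightarrow> ?f absolutely_integrable_on {0<..}"
    by (intro set_integrable_cong)
       (auto simp: norm_divide norm_powr_real_powr exp_minus field_simps)
  finally have "integrable lebesgue (\<lambda>t. indicator {0<..} t *\<^sub>R ?f t)"
    by (simp add: set_integrable_def)
  moreover have "(\<lambda>t. indicator {0<..} t *\<^sub>R ?f t) \<in> borel_measurable lborel"
    by measurable
  ultimately show ?thesis
    unfolding set_integrable_def using integrable_completion by blast
qed

lemma set_integrable_cmult:
  fixes f :: "'a \<Rightarrow> 'b::{real_normed_field, second_countable_topology}"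
  assumes "set_integrable M A f"
  shows "set_integrable M A (\<lambda>t. c * f t)"
proof (cases "c = 0")
  case True
  then show ?thesis by (simp add: set_integrable_def)
next
  case False
  then show ?thesis using assms by (intro set_integrable_mult_right) auto
qed

lemma set_integrable_bounded_powr_exp:
  fixes f :: "real \<Rightarrow> complex" and a C :: real
  assumes "continuous_on {0<..} f" "a > 0"
    and "\<And>t. t > 0 \<Longrightarrow> norm (f t) \<le> C * (t powr (a - 1) * exp (- t))"
  shows "set_integrable lborel {0<..} f"
proof (rule set_integrable_bound)
  have "set_integrable lborel {0<..} (\<lambda>t. t powr (a - 1) * exp (- t))"
    using set_integrable_powr_exp[of a 1] assms(2) by simp
  then show "set_integrable lborel {0<..} (\<lambda>t. \<bar>C\<bar> * (t powr (a - 1) * exp (- t)))"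
    by (rule set_integrable_cmult)
  show "set_borel_measurable lborel {0<..} f"
    using borel_measurable_continuous_on_indicator[OF _ assms(1)]
    by (simp add: set_borel_measurable_def)
  have "norm (f t) \<le> norm (\<bar>C\<bar> * (t powr (a - 1) * exp (- t)))" if "t > 0" for t
    using assms(3)[OF that] mult_right_mono[OF abs_ge_self, of "t powr (a - 1) * exp (- t)" C]
    by (simp add: abs_mult)
  then show "AE t in lborel. t \<in> {0<..} \<longrightarrow> norm (f t) \<le> norm (\<bar>C\<bar> * (t powr (a - 1) * exp (- t)))"
    by auto
qed

lemma continuous_on_cpowr_of_real [continuous_intros]:
  "continuous_on {0<..} (\<lambda>t. complex_of_real t powr s)"
  by (auto intro!: continuous_intros simp: complex_nonpos_Reals_iff)

lemma set_integrable_mellin: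
  assumes "exp_decaying \<phi>" "Re s > 0"
  shows "set_integrable lborel {0<..} (\<lambda>t. of_real t powr (s - 1) * \<phi> t)"
proof -
  obtain C where C: "\<And>t. t > 0 \<Longrightarrow> norm (\<phi> t) \<le> C * exp (- t)"
    and cont: "continuous_on {0<..} \<phi>"
    using assms(1) by (auto simp: exp_decaying_def)
  show ?thesis
  proof (rule set_integrable_bounded_powr_exp)
    show "continuous_on {0<..} (\<lambda>t. of_real t powr (s - 1) * \<phi> t)"
      by (intro continuous_intros cont)
    show "norm (of_real t powr (s - 1) * \<phi> t) \<le> C * (t powr (Re s - 1) * exp (- t))" if "t > 0" for t
      using mult_left_mono[OF C[OF that], of "t powr (Re s - 1)"] that
      by (simp add: norm_mult norm_powr_real_powr mult_ac)
  qed (use assms in auto)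
qed

text \<open>
  Moving the exponent by \<open>h\<close> with \<open>norm h \<le> d\<close> costs a factor of at most \<open>exp (d * \<bar>ln t\<bar>)\<close>, and
  a second such factor absorbs powers of \<open>ln t\<close>. Their product is a power of \<open>t\<close> for large \<open>t\<close> and
  of \<open>1/t\<close> for small \<open>t\<close>. The sum covers both ends of the
  half-line at once, and both summands are integrable against \<open>exp (- t)\<close> when \<open>2 * d < x\<close>.
\<close>

lemma powr_mult_exp_ln_le:
  fixes t x d :: real
  assumes "t > 0"
  shows "t powr (x - 1) * exp (2 * d * \<bar>ln t\<bar>) \<le> t powr (x - 2 * d - 1) + t powr (x + 2 * d - 1)"
proof (cases "ln t \<ge> 0")
  case True
  then have "exp (2 * d * \<bar>ln t\<bar>) = t powr (2 * d)"
    using assms by (simp add: powr_def)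
  then show ?thesis
    using assms by (simp flip: powr_add add: algebra_simps)
next
  case False
  then have "exp (2 * d * \<bar>ln t\<bar>) = t powr (- (2 * d))"
    using assms by (simp add: powr_def)
  then show ?thesis
    using assms by (simp flip: powr_add add: algebra_simps)
qed

text \<open>
  With \<open>w = h * ln t\<close> the left-hand side is \<open>t powr (s - 1) * (exp w - 1 - w)\<close>. Taylor's formula
  leaves \<open>(norm w)\<^sup>2\<close> times an exponential, and the square of the logarithm is absorbed by
  another factor \<open>exp (d * \<bar>ln t\<bar>)\<close>. This bound is uniform enough to differentiate under the
  integral sign.
\<close>

lemma cpowr_first_order_bound:
  fixes t d :: real and s h :: complex
  assumes "t > 0" "d > 0" "norm h \<le> d"
  shows "norm (of_real t powr (s + h - 1) - of_real t powr (s - 1) - h * (of_real t powr (s - 1) * of_real (ln t)))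
         \<le> (norm h)\<^sup>2 * (2 / d\<^sup>2) * (t powr (Re s - 1) * exp (2 * d * \<bar>ln t\<bar>))"
proof -
  define w where "w = h * of_real (ln t)"
  have eq: "of_real t powr (s + h - 1) - of_real t powr (s - 1) - h * (of_real t powr (s - 1) * of_real (ln t))
        = of_real t powr (s - 1) * (exp w - 1 - w)"
  proof -
    have "complex_of_real t powr (s + h - 1) = of_real t powr (s - 1) * exp w"
      using assms(1) by (simp add: powr_def w_def Ln_of_real flip: exp_add) (simp add: algebra_simps)
    then show ?thesis by (simp add: w_def algebra_simps)
  qed
  have "norm (exp w - 1 - w) \<le> exp \<bar>Re w\<bar> * (norm w)\<^sup>2"
    using Taylor_exp[of w 1] by (simp add: numeral_2_eq_2 algebra_simps)
  also have "\<dots> \<le> exp (d * \<bar>ln t\<bar>) * (norm w)\<^sup>2"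
  proof -
    have "\<bar>Re w\<bar> \<le> norm w" by (rule abs_Re_le_cmod)
    also have "norm w \<le> d * \<bar>ln t\<bar>"
      using assms by (simp add: w_def norm_mult mult_right_mono)
    finally show ?thesis by (intro mult_right_mono) auto
  qed
  also have "(norm w)\<^sup>2 \<le> (norm h)\<^sup>2 * (2 / d\<^sup>2) * exp (d * \<bar>ln t\<bar>)"
  proof -
    have "1 + d * \<bar>ln t\<bar> + (d * \<bar>ln t\<bar>)\<^sup>2 / 2 \<le> exp (d * \<bar>ln t\<bar>)"
      by (rule exp_lower_Taylor_quadratic) (use assms in auto)
    moreover have "0 \<le> d * \<bar>ln t\<bar>"
      using assms by simp
    ultimately have "(d * \<bar>ln t\<bar>)\<^sup>2 / 2 \<le> exp (d * \<bar>ln t\<bar>)"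
      by linarith
    then have "(ln t)\<^sup>2 \<le> (2 / d\<^sup>2) * exp (d * \<bar>ln t\<bar>)"
      using assms(2) by (simp add: power_mult_distrib field_simps)
    then have "(norm h)\<^sup>2 * (ln t)\<^sup>2 \<le> (norm h)\<^sup>2 * ((2 / d\<^sup>2) * exp (d * \<bar>ln t\<bar>))"
      by (rule mult_left_mono) auto
    then show ?thesis
      by (simp add: w_def norm_mult power_mult_distrib mult_ac)
  qed
  finally have "norm (exp w - 1 - w) \<le> (norm h)\<^sup>2 * (2 / d\<^sup>2) * exp (2 * d * \<bar>ln t\<bar>)"
    by (simp add: mult_left_mono mult_ac flip: exp_add)
  then have "t powr (Re s - 1) * norm (exp w - 1 - w)
     \<le> t powr (Re s - 1) * ((norm h)\<^sup>2 * (2 / d\<^sup>2) * exp (2 * d * \<bar>ln t\<bar>))"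
    by (rule mult_left_mono) auto
  then show ?thesis
    unfolding eq using assms(1) by (simp add: norm_mult norm_powr_real_powr mult_ac)
qed

lemma has_field_derivative_quadratic_error:
  fixes f :: "complex \<Rightarrow> complex"
  assumes "d > 0" "\<And>h. norm h \<le> d \<Longrightarrow> norm (f (s + h) - f s - h * D) \<le> B * (norm h)\<^sup>2"
  shows "(f has_field_derivative D) (at s)"
  unfolding DERIV_def
proof (rule LIM_zero_cancel, rule Lim_null_comparison)
  show "\<forall>\<^sub>F h in at 0. norm ((f (s + h) - f s) / h - D) \<le> B * norm h"
    unfolding eventually_at
  proof (intro exI[of _ d] conjI ballI impI)
    fix h :: complex assume h: "h \<noteq> 0 \<and> dist h 0 < d"
    have "norm ((f (s + h) - f s) / h - D) = norm (f (s + h) - f s - h * D) / norm h"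
      using h by (simp add: field_simps flip: norm_divide)
    also have "\<dots> \<le> (B * (norm h)\<^sup>2) / norm h"
      using h assms(2)[of h] by (intro divide_right_mono) auto
    finally show "norm ((f (s + h) - f s) / h - D) \<le> B * norm h"
      using h by (simp add: power2_eq_square)
  qed (use assms in auto)
  show "((\<lambda>h. B * norm h) \<longlongrightarrow> 0) (at (0::complex))"
    by (auto intro!: tendsto_eq_intros)
qed

text \<open>
  The derivative is the integral of \<open>t powr (s - 1) * ln t * \<phi> t\<close>: the pointwise first-order bound
  has the dominating function \<open>K\<close> below, so after integration the linearization error is
  \<open>O((norm h)\<^sup>2)\<close>.
\<close>

lemma mellin_holomorphic:
  assumes "exp_decaying \<phi>"
  shows "mellin \<phi> holomorphic_on {s. Re s > 0}"
proof -
  obtain C where C: "\<And>t. t > 0 \<Longrightarrow> norm (\<phi> t) \<le> C * exp (- t)"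
    and cont: "continuous_on {0<..} \<phi>"
    using assms by (auto simp: exp_decaying_def)
  have "\<exists>D. (mellin \<phi> has_field_derivative D) (at s)" if s: "Re s > 0" for s
  proof -
    \<comment> \<open>small enough that the lower exponent \<open>Re s - 2 * d = Re s / 2\<close> stays positive\<close>
    define d where "d = Re s / 4"
    have d: "d > 0" using s by (simp add: d_def)
    define p where "p = (\<lambda>(z::complex) t. of_real t powr (z - 1) * \<phi> t)"
    define q where "q = (\<lambda>t. of_real t powr (s - 1) * of_real (ln t) * \<phi> t)"
    define K where "K = (\<lambda>t. C * (t powr (Re s - 2 * d - 1) + t powr (Re s + 2 * d - 1)) * exp (- t))"
    have intK: "set_integrable lborel {0<..} K"
    proof -
      have "set_integrable lborel {0<..} (\<lambda>t. t powr (Re s - 2 * d - 1) * exp (- t))"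
           "set_integrable lborel {0<..} (\<lambda>t. t powr (Re s + 2 * d - 1) * exp (- t))"
        using set_integrable_powr_exp[of "Re s - 2 * d" 1] set_integrable_powr_exp[of "Re s + 2 * d" 1] s
        by (auto simp: d_def)
      then have "set_integrable lborel {0<..} (\<lambda>t. C * (t powr (Re s - 2 * d - 1) * exp (- t)
                    + t powr (Re s + 2 * d - 1) * exp (- t)))"
        by (intro set_integrable_cmult set_integral_add)
      then show ?thesis by (simp add: K_def algebra_simps)
    qed
    have K: "t powr (Re s - 1) * exp (2 * d * \<bar>ln t\<bar>) * norm (\<phi> t) \<le> K t" if "t > 0" for t
      unfolding K_def using mult_mono[OF powr_mult_exp_ln_le[OF that, of "Re s" d] C[OF that]]
      by (simp add: mult_ac)
    have mellin_eq: "mellin \<phi> z = (LBINT t:{0<..}. p z t)" for z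
      by (simp add: mellin_def p_def)
    have intp: "set_integrable lborel {0<..} (p z)" if "Re z > 0" for z
      unfolding p_def by (rule set_integrable_mellin[OF assms that])
    have intq: "set_integrable lborel {0<..} q"
    proof (rule set_integrable_bound)
      show "set_integrable lborel {0<..} (\<lambda>t. (1 / d) * K t)"
        by (rule set_integrable_cmult[OF intK])
      have "continuous_on {0<..} q"
        unfolding q_def by (intro continuous_intros cont) auto
      then show "set_borel_measurable lborel {0<..} q"
        using borel_measurable_continuous_on_indicator[of "{0<..}" q]
        by (simp add: set_borel_measurable_def)
      have "norm (q t) \<le> norm ((1 / d) * K t)" if t: "t > 0" for t
      proof -
        have "d * \<bar>ln t\<bar> \<le> 2 * d * \<bar>ln t\<bar>" using d by simp
        also have "\<dots> \<le> exp (2 * d * \<bar>ln t\<bar>)" using exp_ge_add_one_self[of "2 * d * \<bar>ln t\<bar>"] by linarith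
        finally have "\<bar>ln t\<bar> \<le> (1 / d) * exp (2 * d * \<bar>ln t\<bar>)"
          using d by (simp add: field_simps)
        then have "(t powr (Re s - 1) * norm (\<phi> t)) * \<bar>ln t\<bar>
             \<le> (t powr (Re s - 1) * norm (\<phi> t)) * ((1 / d) * exp (2 * d * \<bar>ln t\<bar>))"
          by (rule mult_left_mono) auto
        then have "norm (q t) \<le> (1 / d) * (t powr (Re s - 1) * exp (2 * d * \<bar>ln t\<bar>) * norm (\<phi> t))"
          using t by (simp add: q_def norm_mult norm_powr_real_powr mult_ac)
        also have "\<dots> \<le> (1 / d) * K t"
          using K[OF t] d by (intro mult_left_mono) auto
        also have "\<dots> \<le> norm ((1 / d) * K t)"
          unfolding real_norm_def by (rule abs_ge_self)
        finally show ?thesis .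
      qed
      then show "AE t in lborel. t \<in> {0<..} \<longrightarrow> norm (q t) \<le> norm ((1 / d) * K t)" by auto
    qed
    have "(mellin \<phi> has_field_derivative (LBINT t:{0<..}. q t)) (at s)"
    proof (rule has_field_derivative_quadratic_error[OF d])
      fix h :: complex assume h: "norm h \<le> d"
      have "Re s + Re h > 0"
        using h abs_Re_le_cmod[of h] s by (simp add: d_def)
      then have sh: "Re (s + h) > 0" by simp
      have inth: "set_integrable lborel {0<..} (\<lambda>t. h * q t)"
        by (rule set_integrable_cmult[OF intq])
      have "mellin \<phi> (s + h) - mellin \<phi> s - h * (LBINT t:{0<..}. q t)
            = (LBINT t:{0<..}. p (s + h) t - p s t - h * q t)"
        using intp[OF sh] intp[OF s] inth by (simp add: mellin_eq)
      also have "norm \<dots> \<le> (LBINT t:{0<..}. norm (p (s + h) t - p s t - h * q t))"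
        by (intro set_integral_norm_bound set_integral_diff intp s sh inth)
      also have "\<dots> \<le> (LBINT t:{0<..}. ((norm h)\<^sup>2 * (2 / d\<^sup>2)) * K t)"
      proof (rule set_integral_mono)
        show "set_integrable lborel {0<..} (\<lambda>t. norm (p (s + h) t - p s t - h * q t))"
          by (intro set_integrable_norm set_integral_diff intp s sh inth)
        show "set_integrable lborel {0<..} (\<lambda>t. ((norm h)\<^sup>2 * (2 / d\<^sup>2)) * K t)"
          by (rule set_integrable_cmult[OF intK])
        fix t :: real assume "t \<in> {0<..}"
        then have t: "t > 0" by simp
        have "p (s + h) t - p s t - h * q t =
          (of_real t powr (s + h - 1) - of_real t powr (s - 1) - h * (of_real t powr (s - 1) * of_real (ln t))) * \<phi> t"
          by (simp add: p_def q_def algebra_simps)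
        also have "norm \<dots> \<le> ((norm h)\<^sup>2 * (2 / d\<^sup>2) * (t powr (Re s - 1) * exp (2 * d * \<bar>ln t\<bar>))) * norm (\<phi> t)"
          unfolding norm_mult[of _ "\<phi> t"] by (intro mult_right_mono cpowr_first_order_bound t d h) auto
        also have "\<dots> = ((norm h)\<^sup>2 * (2 / d\<^sup>2)) * (t powr (Re s - 1) * exp (2 * d * \<bar>ln t\<bar>) * norm (\<phi> t))"
          by (simp only: mult_ac)
        also have "\<dots> \<le> ((norm h)\<^sup>2 * (2 / d\<^sup>2)) * K t"
          by (intro mult_left_mono K t) auto
        finally show "norm (p (s + h) t - p s t - h * q t) \<le> ((norm h)\<^sup>2 * (2 / d\<^sup>2)) * K t" .
      qed
      also have "\<dots> = ((2 / d\<^sup>2) * (LBINT t:{0<..}. K t)) * (norm h)\<^sup>2"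
        by (subst set_integral_mult_right) (simp only: mult_ac)
      finally show "norm (mellin \<phi> (s + h) - mellin \<phi> s - h * (LBINT t:{0<..}. q t))
                      \<le> ((2 / d\<^sup>2) * (LBINT t:{0<..}. K t)) * (norm h)\<^sup>2" .
    qed
    then show ?thesis by blast
  qed
  then show ?thesis
    by (auto simp: holomorphic_on_def field_differentiable_def intro: has_field_derivative_at_within)
qed

text \<open>
  The function \<open>t powr s * \<phi> t\<close> vanishes at both ends of the half-line, so its derivative has
  integral 0.
\<close>

lemma mellin_by_parts:
  assumes "exp_decaying \<phi>" "exp_decaying \<psi>"
    and deriv: "\<And>t. t > 0 \<Longrightarrow> (\<phi> has_vector_derivative \<psi> t) (at t)"
    and s: "Re s > 0"
  shows "mellin \<psi> (s + 1) = - s * mellin \<phi> s"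
proof -
  obtain C where C: "\<And>t. t > 0 \<Longrightarrow> norm (\<phi> t) \<le> C * exp (- t)"
    using assms by (auto simp: exp_decaying_def)
  define G where "G = (\<lambda>t. of_real t powr s * \<phi> t)"
  define g where "g = (\<lambda>t. s * (of_real t powr (s - 1) * \<phi> t) + of_real t powr ((s + 1) - 1) * \<psi> t)"
  have int\<phi>: "set_integrable lborel {0<..} (\<lambda>t. s * (of_real t powr (s - 1) * \<phi> t))"
    using set_integrable_mellin[OF assms(1) s] by (rule set_integrable_cmult)
  have int\<psi>: "set_integrable lborel {0<..} (\<lambda>t. of_real t powr ((s + 1) - 1) * \<psi> t)"
    by (rule set_integrable_mellin) (use assms in auto)
  have dG: "(G has_vector_derivative g t) (at t)" if "t > 0" for t
  proof -
    have "((\<lambda>z. z powr s) has_field_derivative s * of_real t powr (s - 1)) (at (complex_of_real t))"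
      using that by (intro has_field_derivative_powr) (auto simp: complex_nonpos_Reals_iff)
    then have "((\<lambda>u. complex_of_real u powr s) has_vector_derivative s * of_real t powr (s - 1)) (at t)"
      by (rule has_vector_derivative_real_field)
    from has_vector_derivative_mult[OF this deriv[OF that]] show ?thesis
      by (simp add: G_def g_def algebra_simps)
  qed
  have cg: "continuous_on {0<..} g"
    unfolding g_def using assms(1,2) by (intro continuous_intros) (auto simp: exp_decaying_def)
  have bound: "norm (G t) \<le> C * (t powr Re s * exp (- t))" if "t > 0" for t
    using mult_left_mono[OF C[OF that], of "t powr (Re s)"] that
    by (simp add: G_def norm_mult norm_powr_real_powr mult_ac)
  have "(LBINT t=(0::ereal)..\<infinity>. g t) = 0 - 0"
  proof (rule interval_integral_FTC_integrable[of _ _ G])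
    show "(G has_vector_derivative g x) (at x)" if "0 < ereal x" for x
      using dG that by simp
    show "isCont g x" if "0 < ereal x" for x
      using cg that by (auto simp: continuous_on_eq_continuous_at)
    show "set_integrable lborel (einterval 0 \<infinity>) g"
      unfolding g_def zero_ereal_def einterval_eq by (intro set_integral_add int\<phi> int\<psi>)
    show "((G \<circ> real_of_ereal) \<longlongrightarrow> 0) (at_right 0)"
      unfolding zero_ereal_def ereal_tendsto_simps1
    proof (rule Lim_null_comparison)
      show "\<forall>\<^sub>F t in at_right 0. norm (G t) \<le> C * (t powr Re s * exp (- t))"
        using eventually_at_right_less[of "0::real"] by eventually_elim (use bound in auto)
      show "((\<lambda>t. C * (t powr Re s * exp (- t))) \<longlongrightarrow> 0) (at_right 0)"
        using s by real_asymp
    qed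
    show "((G \<circ> real_of_ereal) \<longlongrightarrow> 0) (at_left \<infinity>)"
      unfolding ereal_tendsto_simps1
    proof (rule Lim_null_comparison)
      show "\<forall>\<^sub>F t in at_top. norm (G t) \<le> C * (t powr Re s * exp (- t))"
        using eventually_gt_at_top[of "0::real"] by eventually_elim (use bound in auto)
      show "((\<lambda>t. C * (t powr Re s * exp (- t))) \<longlongrightarrow> 0) at_top"
        using s by real_asymp
    qed
  qed auto
  then have "0 = (LBINT t:{0<..}. g t)"
    by (simp add: zero_ereal_def interval_integral_to_infinity_eq)
  also have "\<dots> = s * mellin \<phi> s + mellin \<psi> (s + 1)"
    unfolding g_def mellin_def using int\<phi> int\<psi> by (subst set_integral_add) auto
  finally show ?thesis by (simp add: add_eq_0_iff)
qed

text \<open>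
  Analytic continuation of a Mellin transform. Integrating by parts \<open>k\<close> times gives
  \<open>mellin (\<phi> 0) s / \<Gamma>(s) = (-1)\<^sup>k mellin (\<phi> k) (s + k) / \<Gamma>(s + k)\<close>, because \<open>\<Gamma>(s + k)\<close> picks up exactly
  the factors \<open>s (s + 1) \<dots> (s + k - 1)\<close> that integration by parts produces. The right-hand side
  makes sense for \<open>Re s > - k\<close>, and these half-planes exhaust the plane.
\<close>

lemma rGamma_mellin_entire:
  assumes decay: "\<And>k. exp_decaying (\<phi> k)"
    and deriv: "\<And>k t. t > 0 \<Longrightarrow> (\<phi> k has_vector_derivative \<phi> (Suc k) t) (at t)"
  obtains E where "E holomorphic_on UNIV"
    and "\<And>s. Re s > 0 \<Longrightarrow> E s = rGamma s * mellin (\<phi> 0) s"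
proof -
  define H where "H = (\<lambda>k s. (-1) ^ k * rGamma (s + of_nat k) * mellin (\<phi> k) (s + of_nat k))"
  have step: "H (Suc k) s = H k s" if "Re s > - real k" for k s
  proof -
    have "mellin (\<phi> (Suc k)) (s + of_nat k + 1) = - (s + of_nat k) * mellin (\<phi> k) (s + of_nat k)"
      by (rule mellin_by_parts[OF decay decay deriv]) (use that in auto)
    then have "H (Suc k) s = (-1) ^ k * ((s + of_nat k) * rGamma ((s + of_nat k) + 1)) * mellin (\<phi> k) (s + of_nat k)"
      by (simp add: H_def add_ac) (simp add: algebra_simps)
    then show ?thesis
      by (simp only: rGamma_plus1 H_def)
  qed
  have mono: "H m s = H k s" if "k \<le> m" "Re s > - real k" for m k s
    using that(1) by (induction rule: dec_induct) (use that(2) step in auto)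
  \<comment> \<open>the index of some half-plane \<open>Re s > - k\<close> that contains \<open>s\<close>\<close>
  define N where "N = (\<lambda>s. nat \<lceil>- Re s\<rceil> + 1)"
  have N: "Re s > - real (N s)" for s
    unfolding N_def by linarith
  have E: "H (N s) s = H k s" if "Re s > - real k" for k s
    using mono[OF _ N[of s], of k] mono[OF _ that, of "N s"] by (cases "k \<le> N s") auto
  have hol: "H k holomorphic_on {s. Re s > - real k}" for k
  proof -
    have "(mellin (\<phi> k) \<circ> (\<lambda>s. s + of_nat k)) holomorphic_on {s. Re s > - real k}"
      by (rule holomorphic_on_compose_gen[OF _ mellin_holomorphic[OF decay]])
         (auto intro!: holomorphic_intros)
    then show ?thesis
      unfolding H_def o_def by (intro holomorphic_intros)
  qed
  show thesis
  proof (rule that)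
    have "(\<lambda>s. H (N s) s) holomorphic_on (\<Union>k. {s. Re s > - real k})"
    proof (rule holomorphic_on_UN_open)
      show "(\<lambda>s. H (N s) s) holomorphic_on {s. Re s > - real k}" for k
        by (rule holomorphic_transform[OF hol[of k]]) (use E[of k] in auto)
      show "open {s. Re s > - real k}" for k
        by (rule open_halfspace_Re_gt)
    qed
    moreover have "(\<Union>k. {s. Re s > - real k}) = UNIV"
      using N by auto
    ultimately show "(\<lambda>s. H (N s) s) holomorphic_on UNIV" by simp
    show "H (N s) s = rGamma s * mellin (\<phi> 0) s" if "Re s > 0" for s
      using E[of 0 s] that by (simp add: H_def)
  qed
qed

section \<open>Continuation of the integral divided by the Gamma function\<close>

definition fermi :: "real \<Rightarrow> real" where
  "fermi t = 1 / (exp t + 1)"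

text \<open>
  The function \<open>f = fermi\<close> satisfies the differential equation \<open>f' = f\<^sup>2 - f\<close>. Hence the derivative
  of \<open>f * p(f)\<close> is \<open>(x p)'(f) * (f\<^sup>2 - f) = f * q(f)\<close> with \<open>q = (x - 1) (x p)'\<close>, and every derivative of
  \<open>f\<close> is \<open>f\<close> times a polynomial in \<open>f\<close>.
\<close>

fun fermi_poly :: "nat \<Rightarrow> real poly" where
  "fermi_poly 0 = 1"
| "fermi_poly (Suc k) = [:-1, 1:] * pderiv (pCons 0 (fermi_poly k))"

lemma fermi_has_derivative:
  "(fermi has_real_derivative fermi t * (fermi t - 1)) (at t)"
proof -
  have "exp t + 1 \<noteq> 0" by (smt (verit) exp_gt_zero)
  then show ?thesis
    unfolding fermi_def by (auto intro!: derivative_eq_intros simp: field_simps)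
qed

lemma fermi_poly_has_derivative:
  "((\<lambda>t. fermi t * poly (fermi_poly k) (fermi t)) has_real_derivative
     fermi t * poly (fermi_poly (Suc k)) (fermi t)) (at t)"
proof -
  have "((\<lambda>t. poly (pCons 0 (fermi_poly k)) (fermi t)) has_real_derivative
          poly (pderiv (pCons 0 (fermi_poly k))) (fermi t) * (fermi t * (fermi t - 1))) (at t)"
    by (rule DERIV_chain2[OF poly_DERIV fermi_has_derivative])
  then show ?thesis by (simp add: algebra_simps del: pderiv_pCons)
qed

text \<open>
  Since \<open>fermi\<close> takes values in \<open>[0, 1]\<close>, the polynomial factor is bounded, and the remaining
  factor \<open>fermi t\<close> is at most \<open>exp (- t)\<close>.
\<close>

lemma fermi_poly_exp_decaying:
  "exp_decaying (\<lambda>t. complex_of_real (fermi t * poly (fermi_poly k) (fermi t)))"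
  unfolding exp_decaying_def
proof
  show "continuous_on {0<..} (\<lambda>t. complex_of_real (fermi t * poly (fermi_poly k) (fermi t)))"
    by (intro continuous_on_of_real DERIV_continuous_on[OF DERIV_subset[OF fermi_poly_has_derivative]]) auto
  have "bounded (poly (fermi_poly k) ` {0..1})"
    by (intro compact_imp_bounded compact_continuous_image continuous_intros) auto
  then obtain B where B: "\<forall>x\<in>{0..1}. norm (poly (fermi_poly k) x) \<le> B"
    by (auto simp: bounded_iff)
  have "norm (complex_of_real (fermi t * poly (fermi_poly k) (fermi t))) \<le> B * exp (- t)" for t
  proof -
    have "1 / (exp t + 1) \<le> 1 / exp t" "1 / (exp t + 1) \<le> 1 / 1"
      by (intro divide_left_mono; simp add: add_pos_pos)+
    then have f: "0 \<le> fermi t" "fermi t \<le> 1" "fermi t \<le> exp (- t)"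
      by (simp_all add: fermi_def exp_minus divide_inverse)
    then have "\<bar>fermi t\<bar> * \<bar>poly (fermi_poly k) (fermi t)\<bar> \<le> exp (- t) * B"
      using B[rule_format, of "fermi t"] by (intro mult_mono) auto
    then show ?thesis by (simp only: norm_of_real abs_mult mult.commute real_norm_def)
  qed
  then show "\<exists>C. \<forall>t>0. norm (complex_of_real (fermi t * poly (fermi_poly k) (fermi t))) \<le> C * exp (- t)"
    by blast
qed

lemma F_eq_mellin: "F s = mellin (\<lambda>t. complex_of_real (fermi t)) s"
  by (simp add: F_def mellin_def fermi_def)

lemma rGamma_F_entire:
  obtains E where "E holomorphic_on UNIV" "\<And>s. Re s > 0 \<Longrightarrow> E s = rGamma s * F s"
proof -
  define \<phi> where "\<phi> = (\<lambda>k t. complex_of_real (fermi t * poly (fermi_poly k) (fermi t)))"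
  have "exp_decaying (\<phi> k)" for k
    unfolding \<phi>_def by (rule fermi_poly_exp_decaying)
  moreover have "(\<phi> k has_vector_derivative \<phi> (Suc k) t) (at t)" for k t
    unfolding \<phi>_def
    by (intro has_vector_derivative_of_real fermi_poly_has_derivative)
  ultimately obtain E where "E holomorphic_on UNIV"
      "\<And>s. Re s > 0 \<Longrightarrow> E s = rGamma s * mellin (\<phi> 0) s"
    using rGamma_mellin_entire[of \<phi>] by blast
  then show thesis
    using that[of E] by (simp add: F_eq_mellin \<phi>_def)
qed

section \<open>The Dirichlet series in the half-plane of absolute convergence\<close>

text \<open>
  Substituting \<open>b * t\<close> for \<open>t\<close> in Euler's integral. With \<open>b = n\<close> it turns the \<open>n\<close>-th exponential in
  the expansion of \<open>fermi\<close> into the \<open>n\<close>-th term of a Dirichlet series.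
\<close>

lemma has_bochner_integral_Gamma_scaled:
  assumes "Re s > 0" "b > 0"
  shows "has_bochner_integral lborel
           (\<lambda>t. indicator {0<..} t *\<^sub>R (complex_of_real t powr (s - 1) * of_real (exp (- (b * t)))))
           (Gamma s / of_real b powr s)"
proof -
  define f where "f = (\<lambda>t. indicator {0<..} t *\<^sub>R (complex_of_real t powr (s - 1) * of_real (exp (- t))))"
  have "exp_decaying (\<lambda>t. complex_of_real (exp (- t)))"
    unfolding exp_decaying_def by (auto intro!: continuous_intros exI[of _ 1])
  then have int: "set_integrable lborel {0<..} (\<lambda>t. complex_of_real t powr (s - 1) * of_real (exp (- t)))"
    using assms(1) by (rule set_integrable_mellin)
  have "((\<lambda>t. complex_of_real t powr (s - 1) * of_real (exp (- t))) has_integral Gamma s) {0<..}"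
    using Gamma_integral_complex'[OF assms(1)]
    by (simp add: exp_minus divide_inverse)
  then have "(LBINT t:{0<..}. complex_of_real t powr (s - 1) * of_real (exp (- t))) = Gamma s"
    using set_borel_integral_eq_integral(2)[OF int] by (simp add: integral_unique)
  then have "has_bochner_integral lborel f (Gamma s)"
    using int by (simp add: f_def has_bochner_integral_iff set_integrable_def set_lebesgue_integral_def)
  then have "has_bochner_integral lborel (\<lambda>t. f (0 + b * t)) (Gamma s /\<^sub>R \<bar>b\<bar>)"
    using assms(2) by (subst (asm) lborel_has_bochner_integral_real_affine_iff[of b _ _ 0]) auto
  then have "has_bochner_integral lborel (\<lambda>t. of_real b powr (1 - s) * f (0 + b * t))
               (of_real b powr (1 - s) * (Gamma s /\<^sub>R \<bar>b\<bar>))"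
    by (intro has_bochner_integral_mult_right) auto
  also have "(\<lambda>t. of_real b powr (1 - s) * f (0 + b * t)) =
      (\<lambda>t. indicator {0<..} t *\<^sub>R (complex_of_real t powr (s - 1) * of_real (exp (- (b * t)))))"
  proof
    fix t :: real
    show "of_real b powr (1 - s) * f (0 + b * t) =
       indicator {0<..} t *\<^sub>R (complex_of_real t powr (s - 1) * of_real (exp (- (b * t))))"
    proof (cases "t > 0")
      case True
      have "complex_of_real b powr (1 - s) * of_real (b * t) powr (s - 1) = of_real t powr (s - 1)"
        using True assms(2)
        by (simp add: powr_def Ln_of_real ln_mult flip: exp_add of_real_mult) (simp add: algebra_simps)
      then show ?thesis using True assms(2) by (simp add: f_def flip: mult.assoc)
    next
      case False
      then show ?thesis using assms(2) by (simp add: f_def zero_less_mult_iff)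
    qed
  qed
  also have "of_real b powr (1 - s) * (Gamma s /\<^sub>R \<bar>b\<bar>) = Gamma s / of_real b powr s"
    using assms(2) by (simp add: powr_diff scaleR_conv_of_real field_simps)
  finally show ?thesis .
qed

lemma summable_norm_dirichlet:
  assumes "Re s > 1"
  shows "summable (\<lambda>n. norm (1 / of_nat (Suc n) powr s :: complex))"
proof -
  have "norm (1 / of_nat (Suc n) powr s :: complex) = real (Suc n) powr (- Re s)" for n
    using norm_powr_real_powr[of "of_nat (Suc n)" s]
    by (simp add: norm_divide norm_inverse powr_minus divide_inverse del: of_nat_Suc)
  moreover have "summable (\<lambda>n. real (Suc n) powr (- Re s))"
    using assms by (subst summable_Suc_iff) (simp add: summable_real_powr_iff)
  ultimately show ?thesis by simp
qed

lemma fermi_sums: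
  assumes "t > 0"
  shows "(\<lambda>n. (-1) ^ n * exp (- (real (Suc n) * t))) sums fermi t"
proof -
  have "(\<lambda>n. exp (- t) * (- exp (- t)) ^ n) sums (exp (- t) * (1 / (1 - (- exp (- t)))))"
    by (intro sums_mult geometric_sums) (use assms in auto)
  moreover have "exp (- t) * (- exp (- t)) ^ n = (-1) ^ n * exp (- (real (Suc n) * t))" for n
    by (simp add: power_minus[of "exp (- t)"] algebra_simps flip: exp_of_nat_mult exp_add)
  moreover have "exp (- t) * (1 / (1 - (- exp (- t)))) = fermi t"
    using exp_gt_zero[of t] by (simp add: fermi_def exp_minus field_simps)
  ultimately show ?thesis by simp
qed

text \<open>
  The alternating series arises from the series for \<open>zeta\<close> by subtracting twice the terms with
  even base \<open>2 * m\<close>, and these add up to \<open>2 powr (- s)\<close> times the whole series.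
\<close>

lemma eta_sums:
  assumes "Re s > 1"
  shows "(\<lambda>n. (-1) ^ n / of_nat (Suc n) powr s) sums
           ((1 - 2 powr (1 - s)) * (\<Sum>n. 1 / of_nat (Suc n) powr s))"
proof -
  define a where "a = (\<lambda>n. 1 / of_nat (Suc n) powr s :: complex)"
  have a: "a sums suminf a"
    unfolding a_def by (rule summable_sums[OF summable_norm_cancel[OF summable_norm_dirichlet[OF assms]]])
  \<comment> \<open>twice the terms with even base; the base is \<open>Suc n\<close>, so they sit at odd indices\<close>
  define b where "b = (\<lambda>n. if even n then 0 else 2 powr (1 - s) * a ((n - 1) div 2))"
  have "(\<lambda>n. b (2 * n + 1)) sums (2 powr (1 - s) * suminf a)"
    using sums_mult[OF a] by (simp add: b_def)
  also have "?this \<longleftrightarrow> b sums (2 powr (1 - s) * suminf a)"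
  proof (rule sums_mono_reindex)
    show "b n = 0" if "n \<notin> range (\<lambda>n. 2 * n + 1)" for n
      using that by (auto simp: b_def elim!: oddE)
  qed (auto simp: strict_mono_def)
  finally have "b sums (2 powr (1 - s) * suminf a)" .
  from sums_diff[OF a this]
  have "(\<lambda>n. a n - b n) sums ((1 - 2 powr (1 - s)) * suminf a)"
    by (simp add: algebra_simps)
  also have "(\<lambda>n. a n - b n) = (\<lambda>n. (-1) ^ n / of_nat (Suc n) powr s)"
  proof
    fix n
    show "a n - b n = (-1) ^ n / of_nat (Suc n) powr s"
    proof (cases "even n")
      case False
      then obtain m where m: "n = 2 * m + 1" by (elim oddE)
      have "complex_of_nat (Suc n) powr s = 2 powr s * of_nat (Suc m) powr s"
      proof -
        have "complex_of_nat (Suc n) = of_real 2 * of_real (real (Suc m))"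
          by (simp add: m)
        then show ?thesis
          using powr_times_real[of 2 "of_nat (Suc m)" s] by simp
      qed
      then have "b n = 2 * a n"
        using m by (simp add: a_def b_def powr_diff del: of_nat_Suc)
      then have "a n - b n = - a n"
        by simp
      then show ?thesis
        using False by (simp add: a_def)
    qed (simp add: a_def b_def)
  qed
  finally show ?thesis by (simp add: a_def)
qed

text \<open>
  Termwise integration is justified by absolute convergence: the norms of the terms integrate to
  \<open>\<Gamma>(Re s) / n powr Re s\<close>, which is summable exactly because \<open>Re s > 1\<close>.
\<close>

lemma rGamma_F_eq_dirichlet:
  assumes s: "Re s > 1"
  shows "rGamma s * F s = (1 - 2 powr (1 - s)) * (\<Sum>n. 1 / of_nat (Suc n) powr s)"
proof -
  define g where "g = (\<lambda>z n t. indicator {0<..} t *\<^sub>R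
                (complex_of_real t powr (z - 1) * of_real (exp (- (real (Suc n) * t)))))"
  define f where "f = (\<lambda>n t. (-1) ^ n * g s n t)"
  have g: "has_bochner_integral lborel (g z n) (Gamma z / of_nat (Suc n) powr z)" if "Re z > 0" for z n
    using has_bochner_integral_Gamma_scaled[OF that, of "real (Suc n)"] by (simp add: g_def del: of_nat_Suc)
  have f: "has_bochner_integral lborel (f n) ((-1) ^ n * (Gamma s / of_nat (Suc n) powr s))" for n
    unfolding f_def by (intro has_bochner_integral_mult_right g) (use s in auto)
  have "(\<lambda>n. integral\<^sup>L lborel (f n)) sums (\<integral>t. (\<Sum>n. f n t) \<partial>lborel)"
  proof (rule sums_integral)
    show "integrable lborel (f n)" for n
      using f by (simp add: has_bochner_integral_iff)
    have nf: "norm (f n t) = indicator {0<..} t * (t powr (Re s - 1) * exp (- t) ^ Suc n)" for n t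
      by (simp add: f_def g_def norm_mult norm_power norm_powr_real_powr indicator_def algebra_simps
          flip: exp_of_nat_mult exp_add)
    have "summable (\<lambda>n. norm (f n t))" for t
    proof (cases "t > 0")
      case True
      then have "summable (\<lambda>n. exp (- t) ^ Suc n)"
        by (subst summable_Suc_iff) (auto intro!: summable_geometric)
      then show ?thesis unfolding nf by (intro summable_mult)
    qed (simp add: nf)
    then show "AE t in lborel. summable (\<lambda>n. norm (f n t))" by simp
    have "(\<integral>t. norm (f n t) \<partial>lborel) =
            norm (Gamma (complex_of_real (Re s))) * norm (1 / of_nat (Suc n) powr s :: complex)" for n
    proof -
      have "complex_of_real (\<integral>t. norm (f n t) \<partial>lborel) = (\<integral>t. complex_of_real (norm (f n t)) \<partial>lborel)"
        by simp
      \<comment> \<open>taking norms amounts to replacing \<open>s\<close> by its real part, so \<open>g\<close> gives the value again\<close>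
      also have "\<dots> = (\<integral>t. g (of_real (Re s)) n t \<partial>lborel)"
        by (intro Bochner_Integration.integral_cong refl)
           (auto simp: f_def g_def norm_mult norm_power norm_powr_real_powr indicator_def 
                 simp flip: powr_of_real)
      also have "\<dots> = Gamma (of_real (Re s)) / of_nat (Suc n) powr (of_real (Re s))"
        using g[of "of_real (Re s)" n] s by (simp add: has_bochner_integral_iff)
      finally have "norm (complex_of_real (\<integral>t. norm (f n t) \<partial>lborel)) =
                      norm (Gamma (of_real (Re s)) / of_nat (Suc n) powr (complex_of_real (Re s)))"
        by (rule arg_cong)
      moreover have "(\<integral>t. norm (f n t) \<partial>lborel) \<ge> 0" by simp
      ultimately show ?thesis
        using norm_powr_real_powr[of "of_nat (Suc n)" s] norm_powr_real_powr[of "of_nat (Suc n)" "of_real (Re s)"]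
        by (simp add: norm_divide del: of_nat_Suc)
    qed
    then show "summable (\<lambda>n. \<integral>t. norm (f n t) \<partial>lborel)"
      using summable_mult[OF summable_norm_dirichlet[OF s]] by (simp only:)
  qed
  also have "(\<lambda>n. integral\<^sup>L lborel (f n)) = (\<lambda>n. Gamma s * ((-1) ^ n / of_nat (Suc n) powr s))"
    using f by (simp add: has_bochner_integral_iff mult_ac)
  also have "(\<integral>t. (\<Sum>n. f n t) \<partial>lborel) = F s"
    unfolding F_eq_mellin mellin_def set_lebesgue_integral_def
  proof (intro Bochner_Integration.integral_cong refl)
    fix t
    show "(\<Sum>n. f n t) = indicator {0<..} t *\<^sub>R (complex_of_real t powr (s - 1) * of_real (fermi t))"
    proof (cases "t > 0")
      case True
      have "(\<lambda>n. of_real t powr (s - 1) * complex_of_real ((-1) ^ n * exp (- (real (Suc n) * t)))) sums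
              (of_real t powr (s - 1) * of_real (fermi t))"
        by (intro sums_mult sums_of_real fermi_sums True)
      then show ?thesis
        using True by (simp add: f_def g_def mult_ac sums_unique[symmetric])
    qed (simp add: f_def g_def)
  qed
  finally have "(\<lambda>n. rGamma s * (Gamma s * ((-1) ^ n / of_nat (Suc n) powr s))) sums (rGamma s * F s)"
    by (rule sums_mult)
  moreover have "rGamma s * Gamma s = 1"
  proof -
    have "s \<notin> \<int>\<^sub>\<le>\<^sub>0" using s by (auto elim!: nonpos_Ints_cases)
    then show ?thesis by (simp add: rGamma_inverse_Gamma Gamma_eq_zero_iff)
  qed
  ultimately have "(\<lambda>n. (-1) ^ n / of_nat (Suc n) powr s) sums (rGamma s * F s)"
    by (simp flip: mult.assoc)
  with eta_sums[OF s] show ?thesis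
    using sums_unique2 by blast
qed

section \<open>Identification of the zeta function\<close>

lemma remove_sings_nicely_meromorphic_eq:
  assumes "f nicely_meromorphic_on A" "z \<in> A"
  shows "remove_sings f z = f z"
  using assms by (auto simp: nicely_meromorphic_on_def)

text \<open>
  The identity theorem, applied to \<open>f - g\<close>. This difference need not be nicely meromorphic
  (two poles may cancel), so its removable singularities are removed first. As \<open>f\<close> and \<open>g\<close> then
  agree near every point except possibly at the point itself, the normalization of their values
  forces equality there as well.
\<close>

lemma nicely_meromorphic_unique:
  assumes "f nicely_meromorphic_on UNIV" "g nicely_meromorphic_on UNIV"
    and "open U" "U \<noteq> {}" "\<And>z. z \<in> U \<Longrightarrow> f z = g z"
  shows "f = g"
proof
  fix z
  have mero: "(\<lambda>z. f z - g z) meromorphic_on UNIV"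
    using assms(1,2) by (intro meromorphic_intros) (auto simp: nicely_meromorphic_on_def)
  define h where "h = remove_sings (\<lambda>z. f z - g z)"
  obtain a where a: "a \<in> U" using assms(4) by blast
  have hU: "h w = 0" if "w \<in> U" for w
    unfolding h_def
  proof (rule remove_sings_eqI, rule tendsto_eventually)
    show "\<forall>\<^sub>F x in at w. f x - g x = 0"
      using eventually_at_in_open'[OF assms(3) that] by eventually_elim (use assms(5) in auto)
  qed
  have "h nicely_meromorphic_on UNIV"
    unfolding h_def by (rule remove_sings_nicely_meromorphic[OF mero])
  moreover have "\<exists>\<^sub>F w in at a. h w = 0"
    using eventually_at_in_open'[OF assms(3) a]
    by (intro eventually_frequently) (auto elim!: eventually_mono intro: hU)
  ultimately have h0: "h w = 0" for w
    using frequently_eq_meromorphic_imp_constant[of h 0 a UNIV] by auto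
  have "isolated_singularity_at (\<lambda>z. f z - g z) z"
    using mero meromorphic_on_isolated_singularity meromorphic_on_subset by blast
  from eventually_remove_sings_eq_at[OF this]
  have "\<forall>\<^sub>F w in at z. f w = g w"
    by eventually_elim (use h0 in \<open>simp add: h_def\<close>)
  then have "remove_sings f z = remove_sings g z"
    by (intro remove_sings_cong) auto
  then show "f z = g z"
    using remove_sings_nicely_meromorphic_eq assms(1,2) by auto
qed

lemma zeta_eqI:
  assumes "f nicely_meromorphic_on UNIV"
    and "\<And>s. Re s > 1 \<Longrightarrow> f s = (\<Sum>n. 1 / of_nat (Suc n) powr s)"
  shows "zeta = f"
  unfolding zeta_def
proof (rule the_equality)
  fix g assume g: "g nicely_meromorphic_on UNIV \<and> (\<forall>s. Re s > 1 \<longrightarrow> g s = (\<Sum>n. 1 / of_nat (Suc n) powr s))"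
  show "g = f"
  proof (rule nicely_meromorphic_unique)
    show "open {s. Re s > 1}" by (rule open_halfspace_Re_gt)
    have "2 \<in> {s. Re s > 1}" by simp
    then show "{s. Re s > 1} \<noteq> {}" by blast
  qed (use g assms in auto)
qed (use assms in auto)

text \<open>
  A zero would need \<open>norm (2 powr (1 - s)) = 1\<close>, and this norm is \<open>2 powr (1 - Re s)\<close>.
\<close>

lemma one_minus_two_powr_nonzero:
  assumes "Re s \<noteq> 1"
  shows "1 - 2 powr (1 - s) \<noteq> (0::complex)"
proof
  assume "1 - 2 powr (1 - s) = (0::complex)"
  then have "norm (2 powr (1 - s) :: complex) = 1" by simp
  then have "2 powr (1 - Re s) = (1::real)"
    by (subst (asm) norm_powr_real_powr) auto
  then show False using assms by (simp add: powr_def)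
qed

text \<open>
  The entire continuation of \<open>rGamma s * F s\<close>, divided by \<open>1 - 2 powr (1 - s)\<close>, is meromorphic on
  the plane and satisfies the characterization of \<open>zeta\<close>. The zeros of the denominator lie on the
  line \<open>Re s = 1\<close>, so off this line the quotient is analytic and removing singularities does not
  change its values.
\<close>

lemma zeta_eq_F:
  assumes "Re s > 0" "Re s \<noteq> 1"
  shows "zeta s = rGamma s * F s / (1 - 2 powr (1 - s))"
proof -
  obtain E where E: "E holomorphic_on UNIV" "\<And>s. Re s > 0 \<Longrightarrow> E s = rGamma s * F s"
    using rGamma_F_entire by blast
  define f where "f = (\<lambda>s. E s / (1 - 2 powr (1 - s)))"
  have hol2: "(\<lambda>s. 1 - 2 powr (1 - s)) holomorphic_on A" for A :: "complex set"
    by (intro holomorphic_intros) (auto simp: complex_nonpos_Reals_iff)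
  have mero: "f meromorphic_on UNIV"
    unfolding f_def using E(1) hol2
    by (intro meromorphic_on_divide analytic_on_imp_meromorphic_on) (auto simp: analytic_on_open)
  have eq: "remove_sings f z = rGamma z * F z / (1 - 2 powr (1 - z))" if z: "Re z > 0" "Re z \<noteq> 1" for z
  proof -
    have "f holomorphic_on (- {s. Re s = 1})"
      unfolding f_def using one_minus_two_powr_nonzero
      by (intro holomorphic_on_divide hol2 holomorphic_on_subset[OF E(1)]) auto
    moreover have "open (- {s. Re s = 1})"
      by (intro open_Compl closed_halfspace_Re_eq)
    ultimately have "f analytic_on {z}"
      using z(2) by (auto simp: analytic_at)
    then show ?thesis
      using E(2)[OF z(1)] by (simp add: f_def)
  qed
  have "zeta = remove_sings f"
  proof (rule zeta_eqI)
    show "remove_sings f nicely_meromorphic_on UNIV"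
      by (rule remove_sings_nicely_meromorphic[OF mero])
    show "remove_sings f z = (\<Sum>n. 1 / of_nat (Suc n) powr z)" if "Re z > 1" for z
      using that eq[of z] rGamma_F_eq_dirichlet[of z] one_minus_two_powr_nonzero[of z] by simp
  qed
  then show ?thesis using eq assms by simp
qed

theorem theorem1:
  fixes s :: complex
  assumes "s \<in> critical_strip"
  shows "zeta s = 0 \<longleftrightarrow> F s = 0"
proof -
  have s: "0 < Re s" "Re s < 1"
    using assms by (auto simp: critical_strip_def)
  then have "s \<notin> \<int>\<^sub>\<le>\<^sub>0"
    by (auto elim!: nonpos_Ints_cases)
  then have "rGamma s \<noteq> 0"
    by (simp add: rGamma_eq_zero_iff)
  then show ?thesis
    using zeta_eq_F[of s] one_minus_two_powr_nonzero[of s] s by simp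
qed

end
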